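(* Let $D$ be an integral domain with quotient field $K$, and let $T$ be an overring of $D$ (a ring with $D\subseteq T\subseteq K$) that is a principal ideal domain. Let $I:=(D:T)=\{x\in K\mid xT\subseteq D\}$. If $I\neq(0)$, then there is an order isomorphism between $\mathrm{Star}(D)$ and $\{\star\in\mathrm{Mult}_0(D/I,T/I)\mid D/I=(D/I)^\star\}$.
   Context: All rings are commutative with unit. For a ring extension $A\subseteq B$, $\mathbf{F}_A(B)$ is the set of $A$-submodules of $B$, ordered by inclusion; for $I\in\mathbf{F}_A(B)$ and $b\in B$, $(I:b):=\{x\in B\mid bx\in I\}$. A closure operation on a partially ordered set is an extensive, order-preserving, idempotent self-map. For $\mathcal{G}\subseteq\mathbf{F}_A(B)$, a multiplicative operation on $(A,B,\mathcal{G})$ is a closure operation $\star:\mathcal{G}\to\mathcal{G}$, $I\mapsto I^\star$, such that $(I:b)^\star\subseteq(I^\star:b)$ for all $I\in\mathcal{G}$, $b\in B$ with $(I:b)\in\mathcal{G}$. $\mathrm{Mult}(A,B,\mathcal{G})$ is the set of these, ordered by $\star_1\leq\star_2$ iff $I^{\star_1}\subseteq I^{\star_2}$ for all $I\in\mathcal{G}$. Set $\mathcal{F}_0(A,B):=\{I\in\mathbf{F}_A(B)\mid IB=B\}$ and $\mathrm{Mult}_0(A,B):=\mathrm{Mult}(A,B,\mathcal{F}_0(A,B))$. A fractional ideal of $D$ is a $D$-submodule $I$ of $K$ with $dI\subseteq D$ for some $d\in D\setminus\{0\}$; $\mathcal{F}(D)$ is the set of all of them. A star operation on $D$ is a closure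 operation $\star$ on $(\mathcal{F}(D),\subseteq)$ with $x\cdot I^\star=(xI)^\star$ for all $x\in K$, $I\in\mathcal{F}(D)$, and $D^\star=D$. $\mathrm{Star}(D)$ is the set of star operations, ordered pointwise by inclusion. *)

theory Defs
  imports "HOL-Algebra.Algebra"
begin

definition quotient_field_of :: "('a, 'b) ring_scheme \<Rightarrow> 'a set \<Rightarrow> bool" where
  "quotient_field_of K D \<longleftrightarrow>
     field K \<and> subdomain D K \<and>
     (\<forall>x\<in>carrier K. \<exists>a\<in>D. \<exists>b\<in>D - {\<zero>\<^bsub>K\<^esub>}. x = a \<otimes>\<^bsub>K\<^esub> inv\<^bsub>K\<^esub> b)"

text \<open>
  \<open>submodules A B\<close> is the set of \<open>A\<close>-submodules of a ring \<open>B\<close>, for a subring \<open>A\<close> of \<open>B\<close>.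
  Despite its name, the library locale \<^locale>\<open>subalgebra\<close> says exactly this: an additive subgroup
  of \<open>B\<close> closed under multiplication by elements of \<open>A\<close>.
\<close>

definition submodules :: "'a set \<Rightarrow> ('a, 'b) ring_scheme \<Rightarrow> 'a set set" where
  "submodules A B = {I. subalgebra A I B}"

definition colon_elem :: "('a, 'b) ring_scheme \<Rightarrow> 'a set \<Rightarrow> 'a \<Rightarrow> 'a set" where
  "colon_elem B I b = {x \<in> carrier B. b \<otimes>\<^bsub>B\<^esub> x \<in> I}"

definition conductor :: "('a, 'b) ring_scheme \<Rightarrow> 'a set \<Rightarrow> 'a set \<Rightarrow> 'a set" where
  "conductor K D T = {x \<in> carrier K. x <#\<^bsub>K\<^esub> T \<subseteq> D}"

text \<open>
  Self-maps of a set \<open>G\<close> are represented by functions that are \<^const>\<open>undefined\<close> outside \<open>G\<close>,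
  so that two closure operations on \<open>G\<close> are equal as soon as they agree on \<open>G\<close>.
\<close>

definition closure_operation :: "'c::order set \<Rightarrow> ('c \<Rightarrow> 'c) \<Rightarrow> bool" where
  "closure_operation G c \<longleftrightarrow>
     c \<in> G \<rightarrow>\<^sub>E G \<and>
     (\<forall>x\<in>G. x \<le> c x) \<and>
     mono_on G c \<and>
     (\<forall>x\<in>G. c (c x) = c x)"

definition op_le :: "'c::order set \<Rightarrow> ('c \<Rightarrow> 'c) \<Rightarrow> ('c \<Rightarrow> 'c) \<Rightarrow> bool" where
  "op_le G c1 c2 \<longleftrightarrow> (\<forall>x\<in>G. c1 x \<le> c2 x)"

definition order_isomorphism ::
  "'c set \<Rightarrow> ('c \<Rightarrow> 'c \<Rightarrow> bool) \<Rightarrow> 'd set \<Rightarrow> ('d \<Rightarrow> 'd \<Rightarrow> bool) \<Rightarrow> ('c \<Rightarrow> 'd) \<Rightarrow> bool" where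
  "order_isomorphism P leP Q leQ f \<longleftrightarrow>
     bij_betw f P Q \<and> (\<forall>x\<in>P. \<forall>y\<in>P. leP x y \<longleftrightarrow> leQ (f x) (f y))"

definition Mult :: "'a set \<Rightarrow> ('a, 'b) ring_scheme \<Rightarrow> 'a set set \<Rightarrow> ('a set \<Rightarrow> 'a set) set" where
  "Mult A B G =
     {c. G \<subseteq> submodules A B \<and> closure_operation G c \<and>
         (\<forall>I\<in>G. \<forall>b\<in>carrier B. colon_elem B I b \<in> G \<longrightarrow>
            c (colon_elem B I b) \<subseteq> colon_elem B (c I) b)}"

text \<open>
  For a submodule \<open>I\<close> of \<open>B\<close>, \<^term>\<open>ideal_prod B I (carrier B)\<close> is the set of finite sums of
  products \<open>i b\<close> with \<open>i \<in> I\<close> and \<open>b \<in> B\<close>, that is, \<open>IB\<close>.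
\<close>

definition F0 :: "'a set \<Rightarrow> ('a, 'b) ring_scheme \<Rightarrow> 'a set set" where
  "F0 A B = {I \<in> submodules A B. ideal_prod B I (carrier B) = carrier B}"

definition Mult0 :: "'a set \<Rightarrow> ('a, 'b) ring_scheme \<Rightarrow> ('a set \<Rightarrow> 'a set) set" where
  "Mult0 A B = Mult A B (F0 A B)"

definition fractional_ideals :: "('a, 'b) ring_scheme \<Rightarrow> 'a set \<Rightarrow> 'a set set" where
  "fractional_ideals K D =
     {I \<in> submodules D K. \<exists>d\<in>D - {\<zero>\<^bsub>K\<^esub>}. d <#\<^bsub>K\<^esub> I \<subseteq> D}"

definition Star :: "('a, 'b) ring_scheme \<Rightarrow> 'a set \<Rightarrow> ('a set \<Rightarrow> 'a set) set" where
  "Star K D =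
     {c. closure_operation (fractional_ideals K D) c \<and>
         (\<forall>x\<in>carrier K. \<forall>I\<in>fractional_ideals K D. x <#\<^bsub>K\<^esub> c I = c (x <#\<^bsub>K\<^esub> I)) \<and>
         c D = D}"

text \<open>
  For \<open>I \<subseteq> D \<subseteq> T\<close>, the cosets \<open>I + x\<close> do not depend on which of \<open>D\<close> and \<open>T\<close> they are formed in,
  so \<open>D/I\<close> is literally a subset of \<open>T/I\<close>; the quotient rings are taken in the library sense, and
  \<open>D/I\<close> is passed to \<^const>\<open>Mult0\<close> as a set of elements of the ring \<open>T/I\<close>.
\<close>

definition quot_ring :: "('a, 'b) ring_scheme \<Rightarrow> 'a set \<Rightarrow> 'a set \<Rightarrow> 'a set ring" where
  "quot_ring K R I = K\<lparr>carrier := R\<rparr> Quot I"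

end

theory Submission
  imports Defs
begin

text \<open>
  Because \<open>T\<close> is a principal ideal domain and \<open>I \<noteq> 0\<close>, every nonzero fractional ideal \<open>J\<close> of \<open>D\<close>
  satisfies \<open>JT = tT\<close> for some \<open>t \<noteq> 0\<close>. Hence \<open>J = tL\<close> where \<open>L = t\<inverse>J\<close> lies in \<open>T\<close> and \<open>LT = T\<close>
  (\<open>normal_form\<close>). A star operation commutes with multiplication by \<open>t\<close>, so it is determined by its
  values on the \<open>D\<close>-submodules \<open>L\<close> of \<open>T\<close> with \<open>LT = T\<close>, that is, on \<open>\<F>\<^sub>0(D, T)\<close>.
  It maps this set to itself: \<open>I\<close> is the intersection of the fractional ideals \<open>u\<inverse>D\<close> with \<open>u\<close> a
  nonzero element of \<open>T\<close>, hence closed, and \<open>T\<close> is a scalar multiple of \<open>I\<close> (\<open>Star_T\<close>).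

  A restricted star operation is multiplicative because \<open>b(L : b) \<subseteq> L\<close>. In the other direction, let
  \<open>c\<close> be a multiplicative operation and put \<open>(tL)\<^sup>\<star> = t c(L)\<close>. If \<open>sJ \<subseteq> tL\<close>, then \<open>r = t\<inverse>s\<close> lies
  in \<open>T\<close>, because \<open>rJ \<subseteq> T\<close> and \<open>JT = T\<close>; thus \<open>J \<subseteq> (L : r)\<close>, and multiplicativity yields
  \<open>r c(J) \<subseteq> c(L)\<close>, that is, \<open>s c(J) \<subseteq> t c(L)\<close> (\<open>Mult0_scale_mono\<close>). This single inequality says that
  the extension is independent of the representation \<open>tL\<close> and that it is order preserving. So star
  operations on \<open>D\<close> correspond to the elements of \<open>Mult\<^sub>0(D, T)\<close> that fix \<open>D\<close>.

  Finally, \<open>Mult\<^sub>0\<close> does not change when an ideal \<open>I\<close> of \<open>T\<close> that lies in \<open>D\<close> is factored out: if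
  \<open>LT = T\<close>, then \<open>I = I(LT) = L(IT) \<subseteq> LD = L\<close>, so every member of \<open>\<F>\<^sub>0(D, T)\<close> contains \<open>I\<close>, and
  taking images and preimages identifies \<open>\<F>\<^sub>0(D, T)\<close> with \<open>\<F>\<^sub>0(D/I, T/I)\<close>, compatibly with colons
  (\<open>Mult0_quotient_isomorphism\<close>). The theorem is the composition of the two correspondences.
\<close>

section \<open>Transport of closure operations\<close>

lemma order_isomorphismI:
  assumes "\<And>x. x \<in> P \<Longrightarrow> f x \<in> Q" and "\<And>y. y \<in> Q \<Longrightarrow> g y \<in> P" and "\<And>y. y \<in> Q \<Longrightarrow> f (g y) = y"
    and emb: "\<And>x y. x \<in> P \<Longrightarrow> y \<in> P \<Longrightarrow> leP x y \<longleftrightarrow> leQ (f x) (f y)"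
    and antisym: "\<And>x y. x \<in> P \<Longrightarrow> y \<in> P \<Longrightarrow> leP x y \<Longrightarrow> leP y x \<Longrightarrow> x = y"
    and refl: "\<And>x. x \<in> P \<Longrightarrow> leP x x"
  shows "order_isomorphism P leP Q leQ f"
proof -
  have "inj_on f P"
  proof (rule inj_onI)
    fix x y assume xy: "x \<in> P" "y \<in> P" "f x = f y"
    then have "leP x y" "leP y x"
      using emb refl by metis+
    with xy antisym show "x = y" by blast
  qed
  moreover have "f ` P = Q"
    using assms(1-3) by (metis image_eqI image_subsetI subsetI subset_antisym)
  ultimately show ?thesis
    using emb by (auto simp: order_isomorphism_def bij_betw_def)
qed

lemma order_isomorphism_trans:
  assumes "order_isomorphism P leP Q leQ f" and "order_isomorphism Q leQ R leR g"
  shows "order_isomorphism P leP R leR (g \<circ> f)"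
  using assms unfolding order_isomorphism_def
  by (auto intro: bij_betw_trans dest: bij_betwE)

lemma closure_operation_antisym:
  assumes "closure_operation G c" and "closure_operation G c'"
    and "op_le G c c'" and "op_le G c' c"
  shows "c = c'"
proof
  fix x
  show "c x = c' x"
    using assms by (cases "x \<in> G") (auto simp: closure_operation_def op_le_def PiE_def extensional_def intro: antisym)
qed

lemma closure_operation_transport:
  assumes c: "closure_operation G c"
    and f: "f \<in> G \<rightarrow> G'" "mono_on G f" and g: "g \<in> G' \<rightarrow> G" "mono_on G' g"
    and gf: "\<And>x. x \<in> G \<Longrightarrow> g (f x) = x" and fg: "\<And>y. y \<in> G' \<Longrightarrow> f (g y) = y"
  shows "closure_operation G' (\<lambda>y\<in>G'. f (c (g y)))"
proof -
  have cG: "c x \<in> G" "x \<le> c x" "c (c x) = c x" if "x \<in> G" for x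
    using c that by (auto simp: closure_operation_def)
  have cm: "c x \<le> c y" if "x \<in> G" "y \<in> G" "x \<le> y" for x y
    using c that by (auto simp: closure_operation_def dest: mono_onD)
  have gG: "g y \<in> G" if "y \<in> G'" for y using g that by auto
  have fG: "f x \<in> G'" if "x \<in> G" for x using f that by auto
  have ext: "y \<le> f (c (g y))" if "y \<in> G'" for y
    using mono_onD[OF f(2) gG[OF that] cG(1)[OF gG[OF that]] cG(2)[OF gG[OF that]]] fg that by simp
  have mon: "f (c (g x)) \<le> f (c (g y))" if "x \<in> G'" "y \<in> G'" "x \<le> y" for x y
    by (intro mono_onD[OF f(2)] cm cG gG mono_onD[OF g(2)] that)
  show ?thesis
    using ext mon by (auto simp: closure_operation_def cG gG fG gf intro!: mono_onI)
qed

section \<open>Submodules generating the unit ideal\<close>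

lemma submodulesE:
  assumes "J \<in> submodules A R" and "ring R"
  shows "J \<subseteq> carrier R" and "\<zero>\<^bsub>R\<^esub> \<in> J"
    and "\<And>x y. x \<in> J \<Longrightarrow> y \<in> J \<Longrightarrow> x \<oplus>\<^bsub>R\<^esub> y \<in> J"
    and "\<And>a x. a \<in> A \<Longrightarrow> x \<in> J \<Longrightarrow> a \<otimes>\<^bsub>R\<^esub> x \<in> J"
proof -
  interpret ring R by fact
  interpret J: subalgebra A J R using assms by (simp add: submodules_def)
  show "J \<subseteq> carrier R" "\<zero>\<^bsub>R\<^esub> \<in> J" using J.subset J.one_closed by auto
  show "x \<oplus>\<^bsub>R\<^esub> y \<in> J" if "x \<in> J" "y \<in> J" for x y
    using J.m_closed that by auto
  show "a \<otimes>\<^bsub>R\<^esub> x \<in> J" if "a \<in> A" "x \<in> J" for a x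
    using J.smult_closed that by auto
qed

context cring
begin

text \<open>
  Closure under negation comes for free: \<open>- x = (- 1) x\<close>, and \<open>- 1\<close> lies in the subring \<open>A\<close>.
\<close>

lemma submodulesI:
  assumes A: "subring A R" and J: "J \<subseteq> carrier R" "\<zero> \<in> J"
    and add: "\<And>x y. x \<in> J \<Longrightarrow> y \<in> J \<Longrightarrow> x \<oplus> y \<in> J"
    and smult: "\<And>a x. a \<in> A \<Longrightarrow> x \<in> J \<Longrightarrow> a \<otimes> x \<in> J"
  shows "J \<in> submodules A R"
proof -
  have "\<ominus> x \<in> J" if "x \<in> J" for x
  proof -
    have "(\<ominus> \<one>) \<otimes> x \<in> J"
      using subringE(3,5)[OF A] smult that by blast
    moreover have "(\<ominus> \<one>) \<otimes> x = \<ominus> x"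
      using J that l_minus by auto
    ultimately show ?thesis by simp
  qed
  then have "subgroup J (add_monoid R)"
    using J add by (intro add.subgroupI) (auto simp: a_inv_def)
  then show ?thesis
    using smult by (auto simp: submodules_def intro!: subalgebra.intro subalgebra_axioms.intro)
qed

lemma ideal_prod_carrier_subset:
  assumes "J \<subseteq> carrier R"
  shows "ideal_prod R J (carrier R) \<subseteq> carrier R"
proof
  fix z assume "z \<in> ideal_prod R J (carrier R)"
  then show "z \<in> carrier R"
    by induct (use assms in auto)
qed

lemma ideal_prod_carrier_absorb:
  assumes "J \<subseteq> carrier R" and "z \<in> ideal_prod R J (carrier R)" and "r \<in> carrier R"
  shows "r \<otimes> z \<in> ideal_prod R J (carrier R)"
  using assms(2)
proof induct
  case (prod i j)
  then have "r \<otimes> (i \<otimes> j) = i \<otimes> (r \<otimes> j)"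
    using assms by (auto simp: m_lcomm)
  then show ?case
    using prod assms(3) by (simp add: ideal_prod.prod)
next
  case (sum s1 s2)
  then show ?case
    using assms(3) ideal_prod_carrier_subset[OF assms(1)]
    by (simp add: r_distr subset_iff ideal_prod.sum)
qed

lemma subset_ideal_prod_carrier: "J \<subseteq> carrier R \<Longrightarrow> J \<subseteq> ideal_prod R J (carrier R)"
  using ideal_prod.prod[of _ J \<one> "carrier R" R] by fastforce

lemma ideal_prod_carrier_ideal:
  assumes "J \<subseteq> carrier R" and "\<zero> \<in> J"
  shows "ideal (ideal_prod R J (carrier R)) R"
proof -
  let ?P = "ideal_prod R J (carrier R)"
  have P: "?P \<in> submodules (carrier R) R"
    using assms ideal_prod_carrier_subset ideal_prod_carrier_absorb subset_ideal_prod_carrier[OF assms(1)]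
    by (intro submodulesI) (auto simp: carrier_is_subring intro: ideal_prod.sum)
  then have "subgroup ?P (add_monoid R)"
    by (simp add: submodules_def subalgebra_def)
  then show ?thesis
    using ideal_prod_carrier_absorb[OF assms(1)] ideal_prod_carrier_subset[OF assms(1)]
    by (intro idealI[OF ring_axioms]) (auto simp: m_comm subset_iff)
qed

text \<open>
  Since \<open>JR\<close> absorbs multiplication by \<open>R\<close>, the condition \<open>JR = R\<close> only concerns the
  element \<open>1\<close>. Below it is verified, and used, by following how \<open>1\<close> is built up from products.
\<close>

lemma F0_iff: "J \<in> F0 A R \<longleftrightarrow> J \<in> submodules A R \<and> \<one> \<in> ideal_prod R J (carrier R)"
proof -
  have "ideal_prod R J (carrier R) = carrier R"
    if J: "J \<in> submodules A R" "\<one> \<in> ideal_prod R J (carrier R)"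
  proof -
    have JR: "J \<subseteq> carrier R" using J by (intro submodulesE(1) ring_axioms)
    have "r \<in> ideal_prod R J (carrier R)" if "r \<in> carrier R" for r
      using ideal_prod_carrier_absorb[OF JR J(2) that] that by simp
    then show ?thesis using ideal_prod_carrier_subset[OF JR] by blast
  qed
  then show ?thesis by (auto simp: F0_def)
qed

lemma F0_superset:
  assumes "J \<in> F0 A R" and "J \<subseteq> L" and "L \<in> submodules A R"
  shows "L \<in> F0 A R"
proof -
  have "z \<in> ideal_prod R L (carrier R)" if "z \<in> ideal_prod R J (carrier R)" for z
    using that by induct (use assms(2) in \<open>auto intro: ideal_prod.intros\<close>)
  then show ?thesis using assms by (auto simp: F0_iff)
qed

lemma subring_in_F0:
  assumes "subring A R"
  shows "A \<in> F0 A R"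
proof -
  have "A \<in> submodules A R"
    using subringE[OF assms] by (intro submodulesI[OF assms]) auto
  then show ?thesis
    using subset_ideal_prod_carrier[of A] subringE[OF assms] by (auto simp: F0_iff)
qed

lemma colon_elem_submodules:
  assumes "subring A R" and "J \<in> submodules A R" and "b \<in> carrier R"
  shows "colon_elem R J b \<in> submodules A R"
proof (rule submodulesI[OF assms(1)])
  note J = submodulesE[OF assms(2) ring_axioms]
  show "colon_elem R J b \<subseteq> carrier R" "\<zero> \<in> colon_elem R J b"
    using J assms(3) by (auto simp: colon_elem_def)
  show "x \<oplus> y \<in> colon_elem R J b" if "x \<in> colon_elem R J b" "y \<in> colon_elem R J b" for x y
    using that J assms(3) by (auto simp: colon_elem_def r_distr)
  show "a \<otimes> x \<in> colon_elem R J b" if "a \<in> A" "x \<in> colon_elem R J b" for a x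
    using that J(4)[OF that(1), of "b \<otimes> x"] assms(3) subringE(1)[OF assms(1)]
    by (auto simp: colon_elem_def m_lcomm subset_iff)
qed

end

section \<open>Passing to a quotient\<close>

text \<open>
  Quotients are treated through a surjective homomorphism whose kernel \<open>N\<close> is contained in the
  subring \<open>A\<close>; up to isomorphism, \<open>h ` A \<subseteq> S\<close> is the extension \<open>A/N \<subseteq> R/N\<close>. This keeps cosets out of
  the arguments.
\<close>

locale surjective_hom_over_subring = ring_hom_cring R S h
  for R (structure) and S (structure) and h +
  fixes A
  assumes A: "subring A R"
    and surj: "h ` carrier R = carrier S"
    and ker: "a_kernel R S h \<subseteq> A"
begin

definition lift :: "'c set \<Rightarrow> 'a set" where
  "lift Y = {x \<in> carrier R. h x \<in> Y}"

lemma mem_kernel_iff: "k \<in> a_kernel R S h \<longleftrightarrow> k \<in> carrier R \<and> h k = \<zero>\<^bsub>S\<^esub>"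
  unfolding a_kernel_def' by blast

lemma mono_lift: "Y \<subseteq> Z \<Longrightarrow> lift Y \<subseteq> lift Z"
  by (auto simp: lift_def)

lemma image_lift: "Y \<subseteq> carrier S \<Longrightarrow> h ` lift Y = Y"
  using surj by (auto simp: lift_def)

text \<open>
  The kernel \<open>N\<close> satisfies \<open>N = N(JR) = J(NR) \<subseteq> JA \<subseteq> J\<close>, because \<open>NR = N \<subseteq> A\<close>. This is where
  generating the unit ideal matters: a general \<open>A\<close>-submodule of \<open>R\<close> need not contain \<open>N\<close> and would
  not be recovered from its image.
\<close>

lemma kernel_subset_F0:
  assumes "J \<in> F0 A R"
  shows "a_kernel R S h \<subseteq> J"
proof
  fix k assume k: "k \<in> a_kernel R S h"
  note J = submodulesE[of J A R, OF _ R.ring_axioms]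
  have Js: "J \<in> submodules A R" and "\<one> \<in> ideal_prod R J (carrier R)"
    using assms by (auto simp: R.F0_iff)
  have "k \<otimes> z \<in> J" if "z \<in> ideal_prod R J (carrier R)" for z
    using that
  proof induct
    case (prod i j)
    have kc: "k \<in> carrier R" "h k = \<zero>\<^bsub>S\<^esub>" using k mem_kernel_iff by blast+
    have ij: "i \<in> carrier R" "j \<in> carrier R" using prod J(1)[OF Js] by auto
    have "k \<otimes> j \<in> a_kernel R S h"
      using kc ij by (simp add: mem_kernel_iff)
    then have "(k \<otimes> j) \<otimes> i \<in> J" using ker J(4)[OF Js] prod by blast
    then show ?case using kc ij by (simp add: R.m_ac)
  next
    case (sum s1 s2)
    then have "s1 \<in> carrier R" "s2 \<in> carrier R"
      using R.ideal_prod_carrier_subset[OF J(1)[OF Js]] by auto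
    then show ?case
      using sum J(3)[OF Js] k by (simp add: R.r_distr mem_kernel_iff)
  qed
  from this[OF \<open>\<one> \<in> _\<close>] show "k \<in> J" using k by (simp add: mem_kernel_iff)
qed

lemma lift_image:
  assumes "J \<in> F0 A R"
  shows "lift (h ` J) = J"
proof
  have Js: "J \<in> submodules A R" using assms by (simp add: F0_def)
  note J = submodulesE[OF Js R.ring_axioms]
  show "J \<subseteq> lift (h ` J)" using J(1) by (auto simp: lift_def)
  show "lift (h ` J) \<subseteq> J"
  proof
    fix x assume "x \<in> lift (h ` J)"
    then obtain y where y: "x \<in> carrier R" "y \<in> J" "h x = h y" by (auto simp: lift_def)
    then have yc: "y \<in> carrier R" using J(1) by auto
    then have "x \<ominus> y \<in> a_kernel R S h"
      using y by (simp add: mem_kernel_iff R.minus_eq S.r_neg)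
    then have "x \<ominus> y \<in> J" using kernel_subset_F0[OF assms] by auto
    then have "(x \<ominus> y) \<oplus> y \<in> J" using y J(3) by auto
    moreover have "(x \<ominus> y) \<oplus> y = x" using y yc by (simp add: R.minus_eq R.a_assoc R.l_neg)
    ultimately show "x \<in> J" by simp
  qed
qed

lemma image_F0:
  assumes "J \<in> F0 A R"
  shows "h ` J \<in> F0 (h ` A) S"
proof -
  have Js: "J \<in> submodules A R" and one: "\<one> \<in> ideal_prod R J (carrier R)"
    using assms by (auto simp: R.F0_iff)
  note J = submodulesE[OF Js R.ring_axioms]
  have "h ` J \<in> submodules (h ` A) S"
    using ring.img_is_subalgebra[of A J] Js subringE(1)[OF A] by (simp add: submodules_def)
  moreover have "h z \<in> ideal_prod S (h ` J) (carrier S)" if "z \<in> ideal_prod R J (carrier R)" for z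
    using that
  proof induct
    case (prod i j)
    then have "h (i \<otimes> j) = h i \<otimes>\<^bsub>S\<^esub> h j" using J(1) by auto
    then show ?case using prod by (auto intro: ideal_prod.prod)
  next
    case (sum s1 s2)
    then have "h (s1 \<oplus> s2) = h s1 \<oplus>\<^bsub>S\<^esub> h s2"
      using R.ideal_prod_carrier_subset[OF J(1)] by (simp add: subset_iff)
    then show ?case using sum by (auto intro: ideal_prod.sum)
  qed
  ultimately show ?thesis
    using one S.F0_iff by force
qed

lemma lift_submodules:
  assumes "Y \<in> submodules (h ` A) S"
  shows "lift Y \<in> submodules A R"
proof (rule R.submodulesI[OF A])
  note Y = submodulesE[OF assms S.ring_axioms]
  show "lift Y \<subseteq> carrier R" "\<zero> \<in> lift Y" using Y(2) by (auto simp: lift_def)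
  show "x \<oplus> y \<in> lift Y" if "x \<in> lift Y" "y \<in> lift Y" for x y
    using that Y(3) by (auto simp: lift_def)
  show "a \<otimes> x \<in> lift Y" if "a \<in> A" "x \<in> lift Y" for a x
    using that Y(4) subringE(1)[OF A] by (auto simp: lift_def)
qed

text \<open>
  If \<open>1 \<in> YS\<close>, then \<open>(lift Y)R\<close> contains an element congruent to \<open>1\<close> modulo the kernel. It also
  contains the kernel, since \<open>lift Y\<close> does.
\<close>

lemma lift_F0:
  assumes "Y \<in> F0 (h ` A) S"
  shows "lift Y \<in> F0 A R"
proof -
  have Xs: "Y \<in> submodules (h ` A) S" and one: "\<one>\<^bsub>S\<^esub> \<in> ideal_prod S Y (carrier S)"
    using assms by (auto simp: S.F0_iff)
  note Y = submodulesE[OF Xs S.ring_axioms]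
  have Ls: "lift Y \<in> submodules A R" by (rule lift_submodules[OF Xs])
  let ?P = "ideal_prod R (lift Y) (carrier R)"
  have LR: "lift Y \<subseteq> carrier R" by (auto simp: lift_def)
  note P = R.ideal_prod_carrier_subset[OF LR] R.subset_ideal_prod_carrier[OF LR]
  have "\<exists>y\<in>?P. h y = z" if "z \<in> ideal_prod S Y (carrier S)" for z
    using that
  proof induct
    case (prod i j)
    then obtain x y where "x \<in> lift Y" "y \<in> carrier R" "i = h x" "j = h y"
      using image_lift[OF Y(1)] surj by (metis imageE)
    then show ?case
      using LR by (intro bexI[of _ "x \<otimes> y"]) (auto intro: ideal_prod.prod)
  next
    case (sum s1 s2)
    then obtain y1 y2 where y: "y1 \<in> ?P" "y2 \<in> ?P" "h y1 = s1" "h y2 = s2" by auto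
    then have "h (y1 \<oplus> y2) = s1 \<oplus>\<^bsub>S\<^esub> s2"
      using P(1) by (simp add: subset_iff)
    then show ?case using ideal_prod.sum[OF y(1,2)] by blast
  qed
  from this[OF one] obtain y where y: "y \<in> ?P" "h y = \<one>\<^bsub>S\<^esub>" by auto
  have yc: "y \<in> carrier R" using y P(1) by auto
  have "h (\<one> \<ominus> y) = \<zero>\<^bsub>S\<^esub>"
    using yc y by (simp add: R.minus_eq S.r_neg)
  then have "\<one> \<ominus> y \<in> lift Y"
    using Y(2) R.minus_closed[OF R.one_closed yc] by (simp only: lift_def mem_Collect_eq)
  then have "(\<one> \<ominus> y) \<oplus> y \<in> ?P" using P(2) y by (auto intro: ideal_prod.sum)
  moreover have "(\<one> \<ominus> y) \<oplus> y = \<one>" using yc by (simp add: R.minus_eq R.a_assoc R.l_neg)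
  ultimately show ?thesis using Ls by (simp add: R.F0_iff)
qed

lemma lift_colon_elem:
  assumes "b \<in> carrier R"
  shows "lift (colon_elem S Y (h b)) = colon_elem R (lift Y) b"
  using assms by (auto simp: lift_def colon_elem_def)

lemma colon_elem_image:
  assumes "J \<in> F0 A R" and "b \<in> carrier R"
  shows "colon_elem S (h ` J) (h b) = h ` colon_elem R J b"
proof -
  have "h ` lift (colon_elem S (h ` J) (h b)) = colon_elem S (h ` J) (h b)"
    by (rule image_lift) (auto simp: colon_elem_def)
  then show ?thesis
    using lift_colon_elem[OF assms(2), of "h ` J"] lift_image[OF assms(1)] by simp
qed

lemma F0_subset_carrier: "Y \<in> F0 (h ` A) S \<Longrightarrow> Y \<subseteq> carrier S"
  using submodulesE(1)[OF _ S.ring_axioms] by (auto simp: F0_def)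

text \<open>
  Conjugating by the mutually inverse maps \<^term>\<open>image h\<close> and \<^const>\<open>lift\<close> preserves the colon
  condition because \<open>(lift Y : a)\<close> is the preimage of \<open>(Y : h a)\<close>, and every element of \<open>S\<close> has the form
  \<open>h a\<close>.
\<close>

lemma image_Mult0:
  assumes "c \<in> Mult0 A R"
  shows "(\<lambda>Y\<in>F0 (h ` A) S. h ` c (lift Y)) \<in> Mult0 (h ` A) S" (is "?c \<in> _")
proof -
  have cl: "closure_operation (F0 A R) c"
    and colon: "\<And>J b. J \<in> F0 A R \<Longrightarrow> b \<in> carrier R \<Longrightarrow> colon_elem R J b \<in> F0 A R \<Longrightarrow>
      c (colon_elem R J b) \<subseteq> colon_elem R (c J) b"
    using assms by (auto simp: Mult0_def Mult_def)
  have "closure_operation (F0 (h ` A) S) ?c"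
    using image_F0 lift_F0 lift_image image_lift[OF F0_subset_carrier]
    by (intro closure_operation_transport[OF cl]) (auto intro!: mono_onI simp: lift_def)
  moreover have "?c (colon_elem S Y b) \<subseteq> colon_elem S (?c Y) b"
    if Y: "Y \<in> F0 (h ` A) S" and b: "b \<in> carrier S" and C: "colon_elem S Y b \<in> F0 (h ` A) S" for Y b
  proof -
    obtain a where a: "a \<in> carrier R" "b = h a" using b surj by auto
    have eq: "lift (colon_elem S Y b) = colon_elem R (lift Y) a"
      using a lift_colon_elem by simp
    have "c (lift (colon_elem S Y b)) \<subseteq> colon_elem R (c (lift Y)) a"
      using colon[OF lift_F0[OF Y] a(1)] lift_F0[OF C] eq by simp
    then have "h ` c (lift (colon_elem S Y b)) \<subseteq> h ` colon_elem R (c (lift Y)) a" by blast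
    also have "\<dots> \<subseteq> colon_elem S (h ` c (lift Y)) b"
      using a by (auto simp: colon_elem_def intro!: imageI simp flip: hom_mult)
    finally show ?thesis using Y C by simp
  qed
  ultimately show ?thesis by (auto simp: Mult0_def Mult_def F0_def)
qed

lemma lift_Mult0:
  assumes "c \<in> Mult0 (h ` A) S"
  shows "(\<lambda>J\<in>F0 A R. lift (c (h ` J))) \<in> Mult0 A R" (is "?c \<in> _")
proof -
  have cl: "closure_operation (F0 (h ` A) S) c"
    and colon: "\<And>J b. J \<in> F0 (h ` A) S \<Longrightarrow> b \<in> carrier S \<Longrightarrow> colon_elem S J b \<in> F0 (h ` A) S \<Longrightarrow>
      c (colon_elem S J b) \<subseteq> colon_elem S (c J) b"
    using assms by (auto simp: Mult0_def Mult_def)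
  have "closure_operation (F0 A R) ?c"
    using image_F0 lift_F0 lift_image image_lift[OF F0_subset_carrier]
    by (intro closure_operation_transport[OF cl]) (auto intro!: mono_onI simp: lift_def)
  moreover have "?c (colon_elem R J b) \<subseteq> colon_elem R (?c J) b"
    if J: "J \<in> F0 A R" and b: "b \<in> carrier R" and C: "colon_elem R J b \<in> F0 A R" for J b
  proof -
    have "c (h ` colon_elem R J b) \<subseteq> colon_elem S (c (h ` J)) (h b)"
      using colon[OF image_F0[OF J], of "h b"] b image_F0[OF C] colon_elem_image[OF J b] by simp
    from mono_lift[OF this] show ?thesis
      using J C lift_colon_elem[OF b] by simp
  qed
  ultimately show ?thesis by (auto simp: Mult0_def Mult_def F0_def)
qed

theorem Mult0_quotient_isomorphism:
  "order_isomorphism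
     {c \<in> Mult0 A R. c A = A} (op_le (F0 A R))
     {c \<in> Mult0 (h ` A) S. c (h ` A) = h ` A} (op_le (F0 (h ` A) S))
     (\<lambda>c. \<lambda>Y\<in>F0 (h ` A) S. h ` c (lift Y))" (is "order_isomorphism ?P _ ?Q _ ?f")
proof (rule order_isomorphismI[where g = "\<lambda>c. \<lambda>J\<in>F0 A R. lift (c (h ` J))"])
  have AF: "A \<in> F0 A R" "h ` A \<in> F0 (h ` A) S"
    using R.subring_in_F0[OF A] image_F0 by auto
  have cl: "closure_operation (F0 A R) c" if "c \<in> ?P" for c
    using that by (auto simp: Mult0_def Mult_def)
  have cF: "c J \<in> F0 A R" if "c \<in> ?P" "J \<in> F0 A R" for c J
    using cl[OF that(1)] that(2) by (auto simp: closure_operation_def)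
  show "?f c \<in> ?Q" if "c \<in> ?P" for c
    using image_Mult0[of c] that AF by (auto simp: lift_image)
  show "(\<lambda>J\<in>F0 A R. lift (c (h ` J))) \<in> ?P" if "c \<in> ?Q" for c
    using lift_Mult0[of c] that AF by (auto simp: lift_image)
  show "?f (\<lambda>J\<in>F0 A R. lift (c (h ` J))) = c" if "c \<in> ?Q" for c
  proof
    fix Y
    have "c \<in> F0 (h ` A) S \<rightarrow>\<^sub>E F0 (h ` A) S"
      using that by (auto simp: Mult0_def Mult_def closure_operation_def)
    then show "?f (\<lambda>J\<in>F0 A R. lift (c (h ` J))) Y = c Y"
      using lift_F0 image_lift[OF F0_subset_carrier]
      by (cases "Y \<in> F0 (h ` A) S") (auto simp: PiE_def extensional_def Pi_def)
  qed
  show "op_le (F0 A R) c c' \<longleftrightarrow> op_le (F0 (h ` A) S) (?f c) (?f c')" if "c \<in> ?P" "c' \<in> ?P" for c c'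
  proof
    assume "op_le (F0 A R) c c'"
    then show "op_le (F0 (h ` A) S) (?f c) (?f c')"
      using lift_F0 by (auto simp: op_le_def subset_iff)
  next
    assume le: "op_le (F0 (h ` A) S) (?f c) (?f c')"
    show "op_le (F0 A R) c c'"
      unfolding op_le_def
    proof
      fix J assume J: "J \<in> F0 A R"
      have "h ` c J \<subseteq> h ` c' J"
        using le image_F0[OF J] lift_image[OF J] unfolding op_le_def by fastforce
      then show "c J \<subseteq> c' J"
        using mono_lift[of "h ` c J" "h ` c' J"] lift_image[OF cF] that J by simp
    qed
  qed
  show "c = c'" if "c \<in> ?P" "c' \<in> ?P" "op_le (F0 A R) c c'" "op_le (F0 A R) c' c" for c c'
    using closure_operation_antisym[OF cl cl] that by blast
qed (simp add: op_le_def)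

end

section \<open>Star operations and a principal ideal overring\<close>

locale principal_overring = field K for K (structure) +
  fixes D T
  assumes D: "subring D K" and T: "subring T K" and DT: "D \<subseteq> T"
    and quotient: "\<And>x. x \<in> carrier K \<Longrightarrow> \<exists>a\<in>D. \<exists>b\<in>D - {\<zero>}. x = a \<otimes> inv b"
    and pid: "principal_domain (K\<lparr>carrier := T\<rparr>)"
    and conductor_nonzero: "conductor K D T \<noteq> {\<zero>}"
begin

abbreviation "TR \<equiv> K\<lparr>carrier := T\<rparr>"
abbreviation "\<F> \<equiv> fractional_ideals K D"
abbreviation "\<G> \<equiv> F0 D TR"

lemma T_cring: "cring TR" and T_ring: "ring TR"
proof -
  interpret R: principal_domain TR by (rule pid)
  show "cring TR" "ring TR" by unfold_locales
qed

lemma T_subset: "T \<subseteq> carrier K" and D_subset: "D \<subseteq> carrier K"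
  using subringE(1) T D by auto

lemma D_subring_T: "subring D TR"
  using subringE[OF D] DT ring.subring_iff[OF T_ring, of D] subring_is_ring[OF D] by simp

lemma inv_facts:
  assumes "t \<in> carrier K" "t \<noteq> \<zero>"
  shows "inv t \<in> carrier K" "inv t \<noteq> \<zero>" "inv t \<otimes> t = \<one>" "t \<otimes> inv t = \<one>"
proof -
  have "t \<in> Units K" using assms by (simp add: field_Units)
  then show "inv t \<in> carrier K" "inv t \<otimes> t = \<one>" "t \<otimes> inv t = \<one>" by auto
  then show "inv t \<noteq> \<zero>" using assms by auto
qed

lemma mem_scale: "x \<in> t <# J \<longleftrightarrow> (\<exists>j\<in>J. x = t \<otimes> j)"
  by (auto simp: l_coset_def)

lemma scale_mono: "J \<subseteq> L \<Longrightarrow> t <# J \<subseteq> t <# L"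
  unfolding l_coset_def by blast

lemma scale_scale:
  assumes "s \<in> carrier K" "t \<in> carrier K" "J \<subseteq> carrier K"
  shows "s <# (t <# J) = (s \<otimes> t) <# J"
  using assms by (fastforce simp: mem_scale m_assoc subset_iff)

lemma scale_one: "J \<subseteq> carrier K \<Longrightarrow> \<one> <# J = J"
  by (force simp: mem_scale subset_iff)

lemma scale_subset_carrier: "t \<in> carrier K \<Longrightarrow> J \<subseteq> carrier K \<Longrightarrow> t <# J \<subseteq> carrier K"
  by (auto simp: mem_scale subset_iff)

lemma scale_inv:
  assumes "t \<in> carrier K" "t \<noteq> \<zero>" "J \<subseteq> carrier K"
  shows "inv t <# (t <# J) = J" "t <# (inv t <# J) = J"
  using assms by (simp_all add: scale_scale scale_one inv_facts)

lemma zero_scale: "J \<subseteq> carrier K \<Longrightarrow> J \<noteq> {} \<Longrightarrow> \<zero> <# J = {\<zero>}"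
  by (force simp: mem_scale subset_iff)

lemma scale_zero: "t \<in> carrier K \<Longrightarrow> t <# {\<zero>} = {\<zero>}"
  by (auto simp: mem_scale)

lemmas submoduleE = submodulesE[OF _ ring_axioms]

lemma scale_submodules:
  assumes t: "t \<in> carrier K" and J: "J \<in> submodules D K"
  shows "t <# J \<in> submodules D K"
proof (rule submodulesI[OF D])
  note J' = submoduleE[OF J]
  show "t <# J \<subseteq> carrier K" using t J'(1) by (rule scale_subset_carrier)
  show "\<zero> \<in> t <# J" using t J'(2) by (force simp: mem_scale)
  show "x \<oplus> y \<in> t <# J" if xy: "x \<in> t <# J" "y \<in> t <# J" for x y
  proof -
    obtain i j where ij: "i \<in> J" "j \<in> J" "x = t \<otimes> i" "y = t \<otimes> j" using xy by (auto simp: mem_scale)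
    then have "x \<oplus> y = t \<otimes> (i \<oplus> j)" using t J'(1) by (simp add: r_distr subset_iff)
    then show ?thesis using J'(3) ij by (auto simp: mem_scale)
  qed
  show "a \<otimes> x \<in> t <# J" if ax: "a \<in> D" "x \<in> t <# J" for a x
  proof -
    obtain i where i: "i \<in> J" "x = t \<otimes> i" using ax by (auto simp: mem_scale)
    then have "a \<otimes> x = t \<otimes> (a \<otimes> i)" using t J'(1) D_subset ax by (simp add: m_lcomm subset_iff)
    then show ?thesis using J'(4) i ax by (auto simp: mem_scale)
  qed
qed

lemma submodules_T: "J \<in> submodules D TR \<longleftrightarrow> J \<in> submodules D K \<and> J \<subseteq> T"
proof
  assume "J \<in> submodules D TR"
  note J = submodulesE[OF this T_ring]
  show "J \<in> submodules D K \<and> J \<subseteq> T"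
    using J T_subset by (auto intro!: submodulesI[OF D])
next
  assume J: "J \<in> submodules D K \<and> J \<subseteq> T"
  then show "J \<in> submodules D TR"
    using submoduleE[of J D] by (intro cring.submodulesI[OF T_cring D_subring_T]) auto
qed

abbreviation "ext J \<equiv> ideal_prod TR J T"

lemma \<G>_iff: "J \<in> \<G> \<longleftrightarrow> J \<in> submodules D K \<and> J \<subseteq> T \<and> \<one> \<in> ext J"
  using cring.F0_iff[OF T_cring, of J D] by (simp add: submodules_T)

lemma ext_subset_T: "J \<subseteq> T \<Longrightarrow> ext J \<subseteq> T"
  using cring.ideal_prod_carrier_subset[OF T_cring, of J] by simp

lemma scale_ext:
  assumes "x \<in> carrier K" "J \<subseteq> carrier K" "z \<in> ext J"
  shows "x \<otimes> z \<in> ext (x <# J)"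
proof -
  have "z \<in> carrier K \<and> x \<otimes> z \<in> ext (x <# J)"
    using assms(3)
  proof induct
    case (prod i j)
    then have "i \<in> carrier K" "j \<in> carrier K" "x \<otimes> i \<in> x <# J"
      using assms(2) T_subset by (auto simp: mem_scale)
    then show ?case
      using assms(1) prod ideal_prod.prod[of "x \<otimes> i" "x <# J" j T TR] by (simp add: m_assoc)
  next
    case (sum s1 s2)
    then show ?case
      using assms(1) ideal_prod.sum[of "x \<otimes> s1" TR "x <# J" T "x \<otimes> s2"] by (simp add: r_distr)
  qed
  then show ?thesis by simp
qed

text \<open>
  From \<open>JT = T\<close> it follows that \<open>xT = (xJ)T \<subseteq> T\<close>.
\<close>

lemma scalar_in_T:
  assumes "J \<in> \<G>" "x \<in> carrier K" "x <# J \<subseteq> T"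
  shows "x \<in> T"
proof -
  have "x \<otimes> \<one> \<in> ext (x <# J)"
    using assms T_subset by (intro scale_ext) (auto simp: \<G>_iff)
  then show ?thesis using ext_subset_T[OF assms(3)] assms(2) by auto
qed

lemma conductor_subset: "conductor K D T \<subseteq> D"
  using subringE(3)[OF T] by (force simp: conductor_def mem_scale subset_iff)

lemma mem_conductor_iff: "z \<in> conductor K D T \<longleftrightarrow> z \<in> carrier K \<and> (\<forall>t\<in>T. z \<otimes> t \<in> D)"
  by (auto simp: conductor_def l_coset_def)

lemma zero_in_conductor: "\<zero> \<in> conductor K D T"
  using subringE(2)[OF D] T_subset by (simp add: mem_conductor_iff subset_iff)

lemma conductor_mult:
  assumes "z \<in> conductor K D T" "t \<in> T"
  shows "t \<otimes> z \<in> conductor K D T"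
proof -
  have z: "z \<in> carrier K" "\<And>u. u \<in> T \<Longrightarrow> z \<otimes> u \<in> D"
    using assms(1) by (auto simp: mem_conductor_iff)
  have t: "t \<in> carrier K" using assms(2) T_subset by auto
  have "(t \<otimes> z) \<otimes> u \<in> D" if "u \<in> T" for u
  proof -
    have "u \<in> carrier K" using that T_subset by auto
    then have "(t \<otimes> z) \<otimes> u = z \<otimes> (t \<otimes> u)" using z t by (simp add: m_ac)
    then show ?thesis using z(2) subringE(6)[OF T assms(2) that] by simp
  qed
  then show ?thesis using z t by (auto simp: mem_conductor_iff)
qed

lemma conductor_ideal: "ideal (conductor K D T) TR"
proof -
  let ?N = "conductor K D T"
  have "?N \<in> submodules T TR"
  proof (rule cring.submodulesI[OF T_cring])
    show "subring T TR" using ring.carrier_is_subring[OF T_ring] by simp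
    show "?N \<subseteq> carrier TR" using conductor_subset DT by auto
    show "\<zero>\<^bsub>TR\<^esub> \<in> ?N" using zero_in_conductor by simp
    show "x \<oplus>\<^bsub>TR\<^esub> y \<in> ?N" if "x \<in> ?N" "y \<in> ?N" for x y
    proof -
      have "(x \<oplus> y) \<otimes> t \<in> D" if t: "t \<in> T" for t
      proof -
        have "x \<otimes> t \<in> D" "y \<otimes> t \<in> D" "x \<in> carrier K" "y \<in> carrier K" "t \<in> carrier K"
          using \<open>x \<in> ?N\<close> \<open>y \<in> ?N\<close> t T_subset by (auto simp: mem_conductor_iff)
        then show ?thesis using subringE(7)[OF D] by (simp add: l_distr)
      qed
      then show ?thesis using that by (auto simp: mem_conductor_iff)
    qed
    show "a \<otimes>\<^bsub>TR\<^esub> x \<in> ?N" if "a \<in> T" "x \<in> ?N" for a x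
      using conductor_mult that by simp
  qed
  then have "subgroup ?N (add_monoid TR)" by (simp add: submodules_def subalgebra_def)
  moreover have "z \<otimes> t \<in> ?N" if "z \<in> ?N" "t \<in> T" for z t
    using conductor_mult[OF that] m_comm[of z t] that T_subset by (auto simp: mem_conductor_iff)
  ultimately show ?thesis
    using conductor_mult by (intro idealI[OF T_ring]) auto
qed

lemma obtain_conductor_element:
  obtains i where "i \<in> conductor K D T" "i \<noteq> \<zero>"
  using zero_in_conductor conductor_nonzero by blast

text \<open>
  Both kinds of denominators can be exchanged: if \<open>dJ \<subseteq> D\<close> then \<open>J \<subseteq> d\<inverse>T\<close>; conversely, if \<open>J \<subseteq> sT\<close>
  with \<open>s = p/q\<close> and \<open>i\<close> is a nonzero element of the conductor, then \<open>qiJ \<subseteq> p(iT) \<subseteq> D\<close>.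
\<close>

lemma fractional_iff:
  "J \<in> \<F> \<longleftrightarrow> J \<in> submodules D K \<and> (\<exists>s\<in>carrier K. J \<subseteq> s <# T)"
proof
  assume "J \<in> \<F>"
  then obtain d where J: "J \<in> submodules D K" and d: "d \<in> D" "d \<noteq> \<zero>" "d <# J \<subseteq> D"
    by (auto simp: fractional_ideals_def)
  have dc: "d \<in> carrier K" using d D_subset by auto
  have "inv d <# (d <# J) \<subseteq> inv d <# T"
    using d DT by (intro scale_mono) auto
  then have "J \<subseteq> inv d <# T"
    using scale_inv(1)[OF dc d(2) submoduleE(1)[OF J]] by simp
  then show "J \<in> submodules D K \<and> (\<exists>s\<in>carrier K. J \<subseteq> s <# T)"
    using J inv_facts(1)[OF dc d(2)] by auto
next
  assume "J \<in> submodules D K \<and> (\<exists>s\<in>carrier K. J \<subseteq> s <# T)"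
  then obtain s where J: "J \<in> submodules D K" and s: "s \<in> carrier K" "J \<subseteq> s <# T" by auto
  obtain p q where pq: "p \<in> D" "q \<in> D" "q \<noteq> \<zero>" "s = p \<otimes> inv q"
    using quotient[OF s(1)] by auto
  obtain i where i: "i \<in> conductor K D T" "i \<noteq> \<zero>" by (rule obtain_conductor_element)
  have c: "p \<in> carrier K" "q \<in> carrier K" "i \<in> carrier K" "i \<in> D"
    using pq i D_subset conductor_subset by auto
  have q: "inv q \<in> carrier K" "q \<otimes> inv q = \<one>" using inv_facts[OF c(2) pq(3)] by auto
  have "(q \<otimes> i) <# J \<subseteq> D"
  proof
    fix x assume "x \<in> (q \<otimes> i) <# J"
    then obtain t where t: "t \<in> T" "x = (q \<otimes> i) \<otimes> (s \<otimes> t)"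
      using s(2) by (auto simp: mem_scale subset_iff)
    have tc: "t \<in> carrier K" using t T_subset by auto
    have "x = (q \<otimes> inv q) \<otimes> (p \<otimes> (i \<otimes> t))"
      using t(2) pq(4) c q(1) tc by (simp add: m_ac)
    also have "\<dots> = p \<otimes> (i \<otimes> t)" using q c tc by simp
    finally show "x \<in> D"
      using i(1) t(1) pq(1) subringE(6)[OF D] by (auto simp: mem_conductor_iff)
  qed
  moreover have "q \<otimes> i \<in> D - {\<zero>}"
    using c pq i subringE(6)[OF D] integral_iff by auto
  ultimately show "J \<in> \<F>"
    using J by (auto simp: fractional_ideals_def)
qed

lemma \<F>_submodule: "J \<in> \<F> \<Longrightarrow> J \<in> submodules D K"
  by (simp add: fractional_ideals_def)

lemma \<F>_carrier: "J \<in> \<F> \<Longrightarrow> J \<subseteq> carrier K"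
  using submoduleE(1) \<F>_submodule by blast

lemma scale_\<F>:
  assumes "x \<in> carrier K" "J \<in> \<F>"
  shows "x <# J \<in> \<F>"
proof -
  obtain s where s: "s \<in> carrier K" "J \<subseteq> s <# T" and J: "J \<in> submodules D K"
    using assms(2) by (auto simp: fractional_iff)
  have "x <# J \<subseteq> (x \<otimes> s) <# T"
    using scale_mono[OF s(2), of x] scale_scale[OF assms(1) s(1) T_subset] by simp
  then show ?thesis
    using scale_submodules[OF assms(1) J] assms(1) s(1) by (auto simp: fractional_iff)
qed

lemma \<F>I_subset_T: "J \<in> submodules D K \<Longrightarrow> J \<subseteq> T \<Longrightarrow> J \<in> \<F>"
  using scale_one[OF T_subset] by (auto simp: fractional_iff)

lemma \<G>_subset_\<F>: "J \<in> \<G> \<Longrightarrow> J \<in> \<F>"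
  by (auto simp: \<G>_iff intro: \<F>I_subset_T)

lemma \<G>_ne_zero: "J \<in> \<G> \<Longrightarrow> J \<noteq> {\<zero>}"
proof
  assume "J \<in> \<G>" "J = {\<zero>}"
  have "z = \<zero>" if "z \<in> ext {\<zero>}" for z
    using that by induct (use T_subset in auto)
  from this[of "\<one>"] have "\<one> = \<zero>" using \<open>J \<in> \<G>\<close> \<open>J = {\<zero>}\<close> by (simp add: \<G>_iff)
  then show False by simp
qed

lemma scale_\<G>_ne_zero:
  assumes "J \<in> \<G>" "t \<in> carrier K" "t \<noteq> \<zero>"
  shows "t <# J \<noteq> {\<zero>}"
proof
  assume "t <# J = {\<zero>}"
  then have "J = {\<zero>}"
    using scale_inv(1)[OF assms(2,3) \<F>_carrier[OF \<G>_subset_\<F>[OF assms(1)]]] scale_zero inv_facts(1) assms(2,3) by simp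
  then show False using \<G>_ne_zero assms(1) by blast
qed

text \<open>
  After clearing denominators \<open>J\<close> lies in \<open>T\<close>, where the ideal it generates is principal; dividing
  \<open>J\<close> by a generator of that ideal makes it generate \<open>T\<close>.
\<close>

lemma normal_form:
  assumes "J \<in> \<F>" "J \<noteq> {\<zero>}"
  obtains t L where "t \<in> carrier K" "t \<noteq> \<zero>" "L \<in> \<G>" "J = t <# L"
proof -
  interpret R: principal_domain TR by (rule pid)
  obtain s where s: "s \<in> carrier K" "J \<subseteq> s <# T" and J: "J \<in> submodules D K"
    using assms(1) by (auto simp: fractional_iff)
  note J' = submoduleE[OF J]
  have s0: "s \<noteq> \<zero>"
    using s(2) zero_scale[OF T_subset] subringE(2)[OF T] J'(2) assms(2) by blast
  define L where "L = inv s <# J"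
  have LT: "L \<subseteq> T"
    using scale_mono[OF s(2), of "inv s"] scale_inv(1)[OF s(1) s0 T_subset] by (simp add: L_def)
  have L: "L \<in> submodules D K"
    unfolding L_def by (rule scale_submodules[OF inv_facts(1)[OF s(1) s0] J])
  have JL: "J = s <# L" using scale_inv(2)[OF s(1) s0 J'(1)] by (simp add: L_def)
  note L' = submoduleE[OF L]
  have "ideal (ext L) TR"
    using R.ideal_prod_carrier_ideal[of L] LT L'(2) by simp
  then obtain a where a: "a \<in> T" "ext L = PIdl\<^bsub>TR\<^esub> a"
    using R.exists_gen by auto
  have ac: "a \<in> carrier K" using a T_subset by auto
  have LaT: "L \<subseteq> a <# T"
  proof
    fix x assume "x \<in> L"
    then have "x \<in> PIdl\<^bsub>TR\<^esub> a"
      using R.subset_ideal_prod_carrier[of L] LT a(2) by auto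
    then show "x \<in> a <# T"
      using ac T_subset by (auto simp: cgenideal_def mem_scale m_comm subset_iff)
  qed
  have a0: "a \<noteq> \<zero>"
  proof
    assume "a = \<zero>"
    then have "L = {\<zero>}"
      using LaT L'(2) zero_scale[OF T_subset] subringE(2)[OF T] by blast
    then show False using JL scale_zero[OF s(1)] assms(2) by simp
  qed
  have "a \<in> ext L"
    using a R.cgenideal_self[of a] by simp
  then have "inv a \<otimes> a \<in> ext (inv a <# L)"
    by (intro scale_ext L'(1) inv_facts ac a0)
  moreover have "inv a <# L \<subseteq> T"
    using scale_mono[OF LaT, of "inv a"] scale_inv(1)[OF ac a0 T_subset] by simp
  ultimately have "inv a <# L \<in> \<G>"
    using scale_submodules[OF inv_facts(1)[OF ac a0] L] inv_facts(3)[OF ac a0] by (simp add: \<G>_iff)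
  moreover have "J = (s \<otimes> a) <# (inv a <# L)"
    using JL scale_scale[OF s(1) ac, of "inv a <# L"] scale_inv(2)[OF ac a0 L'(1)]
      scale_subset_carrier[OF inv_facts(1)[OF ac a0] L'(1)] by simp
  ultimately show ?thesis
    using that[of "s \<otimes> a" "inv a <# L"] s(1) s0 ac a0 integral_iff by auto
qed

subsection \<open>From multiplicative operations to star operations\<close>

text \<open>
  All sets in the union are equal when \<open>c\<close> is multiplicative (\<open>extend_scale\<close>), so no representation
  of \<open>J\<close> has to be chosen. The zero ideal has none, and for it the inserted \<open>0\<close> gives the value \<open>{0}\<close>; in
  all other cases \<open>0\<close> already belongs to the union.
\<close>

definition extend :: "('a set \<Rightarrow> 'a set) \<Rightarrow> 'a set \<Rightarrow> 'a set" where
  "extend c = (\<lambda>J\<in>\<F>. insert \<zero> (\<Union>{t <# c L |t L. t \<in> carrier K - {\<zero>} \<and> L \<in> \<G> \<and> J = t <# L}))"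

lemma Mult0_D:
  assumes "c \<in> Mult0 D TR"
  shows "\<And>J. J \<in> \<G> \<Longrightarrow> c J \<in> \<G>" "\<And>J. J \<in> \<G> \<Longrightarrow> J \<subseteq> c J" "\<And>J. J \<in> \<G> \<Longrightarrow> c (c J) = c J"
    "\<And>J L. J \<in> \<G> \<Longrightarrow> L \<in> \<G> \<Longrightarrow> J \<subseteq> L \<Longrightarrow> c J \<subseteq> c L"
    "\<And>J b. J \<in> \<G> \<Longrightarrow> b \<in> T \<Longrightarrow> colon_elem TR J b \<in> \<G> \<Longrightarrow> c (colon_elem TR J b) \<subseteq> colon_elem TR (c J) b"
  using assms by (auto simp: Mult0_def Mult_def closure_operation_def dest: mono_onD)

text \<open>
  With \<open>r = t\<inverse>s\<close> the hypothesis reads \<open>rJ \<subseteq> L\<close>. Hence \<open>r \<in> T\<close>, so that the colon \<open>(L : r)\<close> in \<open>T\<close> is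
  available; it contains \<open>J\<close>, and multiplicativity gives \<open>c J \<subseteq> c (L : r) \<subseteq> (c L : r)\<close>.
\<close>

lemma Mult0_scale_mono:
  assumes c: "c \<in> Mult0 D TR" and J: "J \<in> \<G>" and L: "L \<in> \<G>"
    and s: "s \<in> carrier K" and t: "t \<in> carrier K" "t \<noteq> \<zero>"
    and le: "s <# J \<subseteq> t <# L"
  shows "s <# c J \<subseteq> t <# c L"
proof -
  have Jc: "J \<subseteq> carrier K" "J \<subseteq> T" and Lc: "L \<subseteq> carrier K" "L \<subseteq> T"
    using J L T_subset by (auto simp: \<G>_iff)
  define r where "r = inv t \<otimes> s"
  note i = inv_facts[OF t]
  have rc: "r \<in> carrier K" using i s by (simp add: r_def)
  have tr: "t \<otimes> r = s" using i s t by (simp add: r_def m_assoc[symmetric])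
  have rJ: "r <# J \<subseteq> L"
    using scale_mono[OF le, of "inv t"] scale_inv(1)[OF t Lc(1)] scale_scale[OF i(1) s Jc(1)]
    by (simp add: r_def)
  have rT: "r \<in> T" using scalar_in_T[OF J rc] rJ Lc by auto
  have JC: "J \<subseteq> colon_elem TR L r"
    using rJ Jc by (auto simp: colon_elem_def mem_scale subset_iff)
  have "colon_elem TR L r \<in> submodules D TR"
    using cring.colon_elem_submodules[OF T_cring D_subring_T, of L r] L rT by (simp add: F0_def)
  then have C: "colon_elem TR L r \<in> \<G>"
    using cring.F0_superset[OF T_cring J JC] by simp
  have "c J \<subseteq> colon_elem TR (c L) r"
    using Mult0_D(4)[OF c J C JC] Mult0_D(5)[OF c L rT C] by auto
  moreover have "c J \<subseteq> carrier K"
    using Mult0_D(1)[OF c J] T_subset by (auto simp: \<G>_iff)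
  ultimately show ?thesis
  proof (intro subsetI)
    fix x assume *: "c J \<subseteq> colon_elem TR (c L) r" "c J \<subseteq> carrier K" "x \<in> s <# c J"
    then obtain y where y: "y \<in> c J" "x = s \<otimes> y" by (auto simp: mem_scale)
    then have "y \<in> carrier K" "r \<otimes> y \<in> c L" using * by (auto simp: colon_elem_def)
    moreover have "x = t \<otimes> (r \<otimes> y)"
      using tr y(2) m_assoc[OF t(1) rc \<open>y \<in> carrier K\<close>] by simp
    ultimately show "x \<in> t <# c L" by (auto simp: mem_scale)
  qed
qed

text \<open>
  Two representations \<open>tL = sJ\<close> give the same value by the preceding lemma, used in both directions.
\<close>

lemma extend_scale:
  assumes c: "c \<in> Mult0 D TR" and L: "L \<in> \<G>" and t: "t \<in> carrier K" "t \<noteq> \<zero>"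
  shows "extend c (t <# L) = t <# c L"
proof -
  have eq: "s <# c J = t <# c L" if "J \<in> \<G>" "s \<in> carrier K" "s \<noteq> \<zero>" "t <# L = s <# J" for s J
    using Mult0_scale_mono[OF c that(1) L that(2) t] Mult0_scale_mono[OF c L that(1) t(1) that(2,3)]
      that(4) by auto
  have "\<Union>{s <# c J |s J. s \<in> carrier K - {\<zero>} \<and> J \<in> \<G> \<and> t <# L = s <# J} = t <# c L"
  proof (intro equalityI)
    show "\<Union>{s <# c J |s J. s \<in> carrier K - {\<zero>} \<and> J \<in> \<G> \<and> t <# L = s <# J} \<subseteq> t <# c L"
      using eq by blast
    show "t <# c L \<subseteq> \<Union>{s <# c J |s J. s \<in> carrier K - {\<zero>} \<and> J \<in> \<G> \<and> t <# L = s <# J}"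
      using L t by blast
  qed
  moreover have "\<zero> \<in> t <# c L"
    using scale_\<F>[OF t(1) \<G>_subset_\<F>[OF Mult0_D(1)[OF c L]]] submoduleE(2) \<F>_submodule by blast
  ultimately show ?thesis
    using scale_\<F>[OF t(1) \<G>_subset_\<F>[OF L]] by (simp add: extend_def insert_absorb)
qed

lemma zero_\<F>: "{\<zero>} \<in> \<F>"
  using subringE(2)[OF T] D_subset by (intro \<F>I_subset_T submodulesI[OF D]) auto

lemma extend_zero: "extend c {\<zero>} = {\<zero>}"
proof -
  have *: "{t <# c L |t L. t \<in> carrier K - {\<zero>} \<and> L \<in> \<G> \<and> {\<zero>} = t <# L} = {}"
    using scale_\<G>_ne_zero by blast
  show ?thesis using zero_\<F> unfolding extend_def restrict_def * by simp
qed

lemma extend_Star: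
  assumes c: "c \<in> Mult0 D TR" and cD: "c D = D"
  shows "extend c \<in> Star K D"
proof -
  note cG = Mult0_D[OF c]
  have F: "extend c J \<in> \<F>" if "J \<in> \<F>" for J
  proof (cases "J = {\<zero>}")
    case True then show ?thesis using that extend_zero by simp
  next
    case False
    from normal_form[OF that False] obtain t L
      where tL: "t \<in> carrier K" "t \<noteq> \<zero>" "L \<in> \<G>" "J = t <# L" .
    then show ?thesis using extend_scale[OF c tL(3,1,2)] scale_\<F> \<G>_subset_\<F> cG(1) by simp
  qed
  have ext: "J \<subseteq> extend c J" if "J \<in> \<F>" for J
  proof (cases "J = {\<zero>}")
    case True then show ?thesis using extend_zero by simp
  next
    case False
    from normal_form[OF that False] obtain t L
      where tL: "t \<in> carrier K" "t \<noteq> \<zero>" "L \<in> \<G>" "J = t <# L" .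
    then show ?thesis using extend_scale[OF c tL(3,1,2)] scale_mono cG(2) by simp
  qed
  have idem: "extend c (extend c J) = extend c J" if "J \<in> \<F>" for J
  proof (cases "J = {\<zero>}")
    case True then show ?thesis using extend_zero by simp
  next
    case False
    from normal_form[OF that False] obtain t L
      where tL: "t \<in> carrier K" "t \<noteq> \<zero>" "L \<in> \<G>" "J = t <# L" .
    then show ?thesis
      using extend_scale[OF c tL(3,1,2)] extend_scale[OF c cG(1)[OF tL(3)] tL(1,2)] cG(3) by simp
  qed
  have mono: "extend c J \<subseteq> extend c J'" if JJ: "J \<in> \<F>" "J' \<in> \<F>" "J \<subseteq> J'" for J J'
  proof (cases "J = {\<zero>}")
    case True
    then show ?thesis using extend_zero submoduleE(2)[OF \<F>_submodule[OF F[OF JJ(2)]]] by simp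
  next
    case False
    then have "J' \<noteq> {\<zero>}"
      using JJ submoduleE(2)[OF \<F>_submodule[OF JJ(1)]] by blast
    from normal_form[OF JJ(2) this] obtain t L
      where tL: "t \<in> carrier K" "t \<noteq> \<zero>" "L \<in> \<G>" "J' = t <# L" .
    from normal_form[OF JJ(1) False] obtain s M
      where sM: "s \<in> carrier K" "s \<noteq> \<zero>" "M \<in> \<G>" "J = s <# M" .
    show ?thesis
      using extend_scale[OF c tL(3,1,2)] extend_scale[OF c sM(3,1,2)] tL(4) sM(4)
        Mult0_scale_mono[OF c sM(3) tL(3) sM(1) tL(1,2)] JJ(3) by simp
  qed
  have hom: "x <# extend c J = extend c (x <# J)" if x: "x \<in> carrier K" and J: "J \<in> \<F>" for x J
  proof (cases "J = {\<zero>} \<or> x = \<zero>")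
    case True
    have "\<zero> <# M = {\<zero>}" if "M \<in> \<F>" for M
      using zero_scale[OF \<F>_carrier[OF that]] submoduleE(2)[OF \<F>_submodule[OF that]] by blast
    then show ?thesis using True x J F extend_zero scale_zero by auto
  next
    case False
    then have "J \<noteq> {\<zero>}" "x \<noteq> \<zero>" by auto
    from normal_form[OF J \<open>J \<noteq> {\<zero>}\<close>] obtain t L
      where tL: "t \<in> carrier K" "t \<noteq> \<zero>" "L \<in> \<G>" "J = t <# L" .
    have xt: "x \<otimes> t \<in> carrier K" "x \<otimes> t \<noteq> \<zero>" using x tL \<open>x \<noteq> \<zero>\<close> integral_iff by auto
    have "M \<in> \<G> \<Longrightarrow> x <# (t <# M) = (x \<otimes> t) <# M" for M
      using scale_scale[OF x tL(1)] \<F>_carrier \<G>_subset_\<F> by blast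
    then show ?thesis
      using extend_scale[OF c tL(3,1,2)] extend_scale[OF c tL(3) xt] tL(3,4) cG(1) by simp
  qed
  have "D \<in> \<G>" using cring.subring_in_F0[OF T_cring D_subring_T] .
  then have "extend c D = D"
    using extend_scale[OF c _ one_closed one_not_zero, of D] scale_one[OF D_subset] cD by simp
  moreover have "closure_operation \<F> (extend c)"
    unfolding closure_operation_def
    using F ext idem mono by (intro conjI ballI mono_onI PiE_I) (simp_all add: extend_def)
  ultimately show ?thesis using hom by (auto simp: Star_def)
qed

subsection \<open>From star operations to multiplicative operations\<close>

lemma Star_D:
  assumes "c \<in> Star K D"
  shows "\<And>J. J \<in> \<F> \<Longrightarrow> c J \<in> \<F>" "\<And>J. J \<in> \<F> \<Longrightarrow> J \<subseteq> c J" "\<And>J. J \<in> \<F> \<Longrightarrow> c (c J) = c J"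
    "\<And>J L. J \<in> \<F> \<Longrightarrow> L \<in> \<F> \<Longrightarrow> J \<subseteq> L \<Longrightarrow> c J \<subseteq> c L"
    "\<And>x J. x \<in> carrier K \<Longrightarrow> J \<in> \<F> \<Longrightarrow> c (x <# J) = x <# c J"
    "c D = D"
proof -
  have cl: "closure_operation \<F> c" and cD: "c D = D"
    and hom: "\<And>x J. x \<in> carrier K \<Longrightarrow> J \<in> \<F> \<Longrightarrow> x <# c J = c (x <# J)"
    using assms unfolding Star_def by blast+
  show "c J \<in> \<F>" "J \<subseteq> c J" "c (c J) = c J" if "J \<in> \<F>" for J
    using cl that unfolding closure_operation_def by auto
  show "c J \<subseteq> c L" if "J \<in> \<F>" "L \<in> \<F>" "J \<subseteq> L" for J L
    using cl that unfolding closure_operation_def by (blast dest: mono_onD)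
  show "c (x <# J) = x <# c J" if "x \<in> carrier K" "J \<in> \<F>" for x J
    using hom[OF that] by simp
  show "c D = D" by (rule cD)
qed

lemma T_\<F>: "T \<in> \<F>" and D_\<F>: "D \<in> \<F>"
proof -
  have "T \<in> submodules D K"
    using subringE(1,2,6,7)[OF T] DT by (intro submodulesI[OF D]) blast+
  moreover have "D \<in> submodules D K"
    using subringE(1,2,6,7)[OF D] by (intro submodulesI[OF D]) blast+
  ultimately  show "T \<in> \<F>" "D \<in> \<F>" using DT by (auto intro: \<F>I_subset_T)
qed

text \<open>
  For \<open>t \<in> T\<close> the set \<open>tI\<close> lies in \<open>D\<close>, so \<open>t c(I) = c(tI) \<subseteq> c(D) = D\<close>; hence \<open>c(I)T \<subseteq> D\<close>.
\<close>

lemma Star_conductor: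
  assumes c: "c \<in> Star K D"
  shows "c (conductor K D T) \<subseteq> conductor K D T"
proof
  let ?N = "conductor K D T"
  have "?N \<in> submodules D K"
    using ring.ideal_is_subalgebra[OF T_ring, of D] conductor_ideal DT submodules_T
    by (simp add: submodules_def)
  then have N: "?N \<in> \<F>" using conductor_subset DT by (auto intro: \<F>I_subset_T)
  fix x assume x: "x \<in> c ?N"
  then have xc: "x \<in> carrier K" using \<F>_carrier[OF Star_D(1)[OF c N]] by auto
  have "x \<otimes> t \<in> D" if t: "t \<in> T" for t
  proof -
    have tc: "t \<in> carrier K" using t T_subset by auto
    have "t <# ?N \<subseteq> D" using conductor_mult[OF _ t] conductor_subset unfolding l_coset_def by blast
    then have "t <# c ?N \<subseteq> D"
      using Star_D(4)[OF c scale_\<F>[OF tc N] D_\<F>] Star_D(5)[OF c tc N] Star_D(6)[OF c] by simp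
    then show ?thesis using x xc tc by (auto simp: mem_scale m_comm subset_iff)
  qed
  then show "x \<in> ?N" using xc by (auto simp: mem_conductor_iff)
qed

text \<open>
  The conductor is a nonzero principal ideal \<open>aT\<close> of \<open>T\<close>, so \<open>a c(T) = c(aT) \<subseteq> aT\<close>, and \<open>a\<close>
  cancels.
\<close>

lemma Star_T:
  assumes c: "c \<in> Star K D"
  shows "c T = T"
proof
  interpret R: principal_domain TR by (rule pid)
  obtain a where a: "a \<in> T" "conductor K D T = PIdl\<^bsub>TR\<^esub> a"
    using R.exists_gen[OF conductor_ideal] by auto
  have ac: "a \<in> carrier K" using a T_subset by auto
  have N: "conductor K D T = a <# T"
    unfolding a(2) using ac T_subset by (auto simp: cgenideal_def mem_scale m_comm subset_iff)
  have a0: "a \<noteq> \<zero>"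
    using N conductor_nonzero zero_scale[OF T_subset] subringE(2)[OF T] by blast
  have "a <# c T \<subseteq> a <# T"
    using Star_conductor[OF c] Star_D(5)[OF c ac T_\<F>] by (simp add: N)
  then have "inv a <# (a <# c T) \<subseteq> inv a <# (a <# T)" by (rule scale_mono)
  then show "c T \<subseteq> T"
    using scale_inv(1)[OF ac a0] T_subset \<F>_carrier[OF Star_D(1)[OF c T_\<F>]] by simp
  show "T \<subseteq> c T" using Star_D(2)[OF c T_\<F>] .
qed

text \<open>
  If \<open>LT = T\<close> and \<open>L \<subseteq> T\<close>, then \<open>c(L) \<subseteq> c(T) = T\<close>, so \<open>c(L)\<close> is again a submodule of \<open>T\<close> and
  generates the unit ideal because it contains \<open>L\<close>.
\<close>

lemma restrict_Star:
  assumes c: "c \<in> Star K D"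
  shows "restrict c \<G> \<in> Mult0 D TR"
proof -
  have G: "c J \<in> \<G>" if J: "J \<in> \<G>" for J
  proof -
    have "c J \<subseteq> T"
      using Star_D(4)[OF c \<G>_subset_\<F>[OF J] T_\<F>] Star_T[OF c] J by (auto simp: \<G>_iff)
    then have "c J \<in> submodules D TR"
      using \<F>_submodule[OF Star_D(1)[OF c \<G>_subset_\<F>[OF J]]] by (simp add: submodules_T)
    then show ?thesis
      using cring.F0_superset[OF T_cring J Star_D(2)[OF c \<G>_subset_\<F>[OF J]]] by simp
  qed
  have "closure_operation \<G> (restrict c \<G>)"
    using G Star_D(2-4)[OF c] \<G>_subset_\<F> by (auto simp: closure_operation_def intro!: mono_onI, blast+)
  moreover have "c (colon_elem TR J b) \<subseteq> colon_elem TR (c J) b"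
    if J: "J \<in> \<G>" and b: "b \<in> T" and C: "colon_elem TR J b \<in> \<G>" for J b
  proof
    fix x assume x: "x \<in> c (colon_elem TR J b)"
    have bc: "b \<in> carrier K" using b T_subset by auto
    have "b <# colon_elem TR J b \<subseteq> J" by (auto simp: mem_scale colon_elem_def)
    then have "b <# c (colon_elem TR J b) \<subseteq> c J"
      using Star_D(4)[OF c scale_\<F>[OF bc \<G>_subset_\<F>[OF C]] \<G>_subset_\<F>[OF J]]
        Star_D(5)[OF c bc \<G>_subset_\<F>[OF C]] by simp
    then show "x \<in> colon_elem TR (c J) b"
      using x G[OF C] by (auto simp: colon_elem_def mem_scale \<G>_iff subset_iff)
  qed
  ultimately show ?thesis by (auto simp: Mult0_def Mult_def F0_def)
qed

text \<open>
  This follows from \<open>c(xJ) = x c(J)\<close> with \<open>x = 0\<close>.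
\<close>

lemma Star_zero:
  assumes c: "c \<in> Star K D"
  shows "c {\<zero>} = {\<zero>}"
proof -
  have "c (\<zero> <# {\<zero>}) = \<zero> <# c {\<zero>}" using Star_D(5)[OF c zero_closed zero_\<F>] .
  moreover have "\<zero> <# c {\<zero>} = {\<zero>}"
    using Star_D(2)[OF c zero_\<F>] \<F>_carrier[OF Star_D(1)[OF c zero_\<F>]] by (intro zero_scale) auto
  ultimately show ?thesis by (simp add: scale_zero)
qed

theorem Star_Mult0_isomorphism:
  "order_isomorphism (Star K D) (op_le \<F>) {c \<in> Mult0 D TR. c D = D} (op_le \<G>) (\<lambda>c. restrict c \<G>)"
proof (rule order_isomorphismI[where g = extend])
  have D: "D \<in> \<G>" using cring.subring_in_F0[OF T_cring D_subring_T] .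
  show "restrict c \<G> \<in> {c \<in> Mult0 D TR. c D = D}" if "c \<in> Star K D" for c
    using restrict_Star[OF that] Star_D(6)[OF that] D by simp
  show "extend c \<in> Star K D" if "c \<in> {c \<in> Mult0 D TR. c D = D}" for c
    using that extend_Star by simp
  show "restrict (extend c) \<G> = c" if c: "c \<in> {c \<in> Mult0 D TR. c D = D}" for c
  proof
    fix J
    have "c \<in> extensional \<G>" using c by (auto simp: Mult0_def Mult_def closure_operation_def PiE_def)
    moreover have "extend c J = c J" if J: "J \<in> \<G>"
    proof -
      have "J \<subseteq> carrier K" "c J \<subseteq> carrier K"
        using J Mult0_D(1)[of c J] c \<F>_carrier \<G>_subset_\<F> by auto
      then show ?thesis
        using extend_scale[of c, OF _ J one_closed one_not_zero] c by (simp add: scale_one)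
    qed
    ultimately show "restrict (extend c) \<G> J = c J" by (simp add: restrict_def extensional_def)
  qed
  show "op_le \<F> c c' \<longleftrightarrow> op_le \<G> (restrict c \<G>) (restrict c' \<G>)"
    if c: "c \<in> Star K D" and c': "c' \<in> Star K D" for c c'
  proof
    assume "op_le \<F> c c'"
    then show "op_le \<G> (restrict c \<G>) (restrict c' \<G>)"
      using \<G>_subset_\<F> by (simp add: op_le_def)
  next
    assume le: "op_le \<G> (restrict c \<G>) (restrict c' \<G>)"
    show "op_le \<F> c c'"
      unfolding op_le_def
    proof
      fix J assume J: "J \<in> \<F>"
      show "c J \<subseteq> c' J"
      proof (cases "J = {\<zero>}")
        case True
        then show ?thesis using Star_zero[OF c] Star_zero[OF c'] by simp
      next
        case False
        from normal_form[OF J False] obtain t L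
          where tL: "t \<in> carrier K" "t \<noteq> \<zero>" "L \<in> \<G>" "J = t <# L" .
        have "c L \<subseteq> c' L" using le tL(3) by (simp add: op_le_def)
        then show ?thesis
          using Star_D(5)[OF c tL(1) \<G>_subset_\<F>[OF tL(3)]]
            Star_D(5)[OF c' tL(1) \<G>_subset_\<F>[OF tL(3)]] tL(4) scale_mono by simp
      qed
    qed
  qed
  show "c = c'" if "c \<in> Star K D" "c' \<in> Star K D" "op_le \<F> c c'" "op_le \<F> c' c" for c c'
    using that closure_operation_antisym by (auto simp: Star_def)
qed (simp add: op_le_def)

end

section \<open>The isomorphism\<close>

theorem corollary6p5:
  fixes K :: "('a, 'b) ring_scheme" (structure) and D T I :: "'a set"
  assumes "quotient_field_of K D"
    and "subring T K" and "D \<subseteq> T"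
    and "principal_domain (K\<lparr>carrier := T\<rparr>)"
    and "I = conductor K D T"
    and "I \<noteq> {\<zero>}"
  shows "\<exists>\<phi>. order_isomorphism
           (Star K D) (op_le (fractional_ideals K D))
           {c \<in> Mult0 (carrier (quot_ring K D I)) (quot_ring K T I).
              c (carrier (quot_ring K D I)) = carrier (quot_ring K D I)}
           (op_le (F0 (carrier (quot_ring K D I)) (quot_ring K T I)))
           \<phi>"
proof -
  let ?R = "K\<lparr>carrier := T\<rparr>"
  interpret field K using assms(1) by (simp add: quotient_field_of_def)
  have D: "subring D K"
    using assms(1) by (auto simp: quotient_field_of_def subdomain_def subcring_def)
  interpret principal_overring K D T
  proof (intro principal_overring.intro principal_overring_axioms.intro)
    show "field K" by (rule field_axioms)
    show "\<exists>a\<in>D. \<exists>b\<in>D - {\<zero>}. x = a \<otimes> inv b" if "x \<in> carrier K" for x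
      using assms(1) that unfolding quotient_field_of_def by blast
    show "conductor K D T \<noteq> {\<zero>}" using assms(5,6) by blast
  qed (fact D assms(2-4))+
  have I: "ideal I ?R" using conductor_ideal assms(5) by simp
  interpret I: ideal I ?R by (rule I)
  let ?h = "\<lambda>x. I +>\<^bsub>?R\<^esub> x"
  interpret h: surjective_hom_over_subring ?R "?R Quot I" ?h D
  proof (intro surjective_hom_over_subring.intro surjective_hom_over_subring_axioms.intro)
    show "ring_hom_cring ?R (?R Quot I) ?h"
      using I.rcos_ring_hom_cring[OF T_cring] .
    show "subring D ?R" by (rule D_subring_T)
    show "?h ` carrier ?R = carrier (?R Quot I)"
      by (auto simp: FactRing_def A_RCOSETS_def')
    show "a_kernel ?R (?R Quot I) ?h \<subseteq> D"
    proof
      fix x assume "x \<in> a_kernel ?R (?R Quot I) ?h"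
      then have "x \<in> carrier ?R" "?h x = I"
        unfolding a_kernel_def' by (auto simp: FactRing_def)
      then have "x \<in> I" using I.rcos_const_imp_mem by blast
      then show "x \<in> D" using conductor_subset assms(5) by auto
    qed
  qed
  \<comment> \<open>A coset is the same set whether it is formed in \<open>D\<close> or in \<open>T\<close>.\<close>
  have hD: "?h ` D = carrier (quot_ring K D I)"
    by (auto simp: quot_ring_def FactRing_def A_RCOSETS_def' a_r_coset_def r_coset_def)
  show ?thesis
    using order_isomorphism_trans[OF Star_Mult0_isomorphism h.Mult0_quotient_isomorphism]
    unfolding hD by (auto simp: quot_ring_def)
qed

end
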